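(* Let $\pi:G\to H$ be an open continuous homomorphism of a topological group $G$ onto a topological group $H$. If $G$ is $Pm$-factorizable, then $H$ is $Pm$-factorizable.
   Context: All topological spaces (in particular all topological groups) are assumed Hausdorff. A continuous map $f:X\to Y$ is perfect if it is closed, onto, and all fibers $f^{-1}(y)$ are compact; a perfect homomorphism is a continuous group homomorphism that is a perfect map. A topological group $G$ is $Pm$-factorizable if for every continuous mapping $f:G\to M$ to a metrizable space $M$ there are a perfect homomorphism $\pi:G\to K$ onto a second-countable topological group $K$ and a continuous mapping $g:K\to M$ such that $f=g\circ\pi$. *)

theory Defs
  imports "HOL-Analysis.Analysis" "HOL-Algebra.Group"
begin

locale topological_group = group G for G :: "('a, 'm) monoid_scheme" (structure) +
  fixes T :: "'a topology"
  assumes topspace_eq_carrier: "topspace T = carrier G"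
    and Hausdorff: "Hausdorff_space T"
    and continuous_mult: "continuous_map (prod_topology T T) T (\<lambda>(x, y). x \<otimes> y)"
    and continuous_inv: "continuous_map T T (\<lambda>x. inv x)"

text \<open>
  The continuous map \<open>f : G \<rightarrow> M\<close> is a composite \<open>g \<circ> p\<close> of a perfect homomorphism \<open>p\<close> onto a
  second-countable (Hausdorff) topological group \<open>(K, S)\<close> and a continuous map \<open>g : K \<rightarrow> M\<close>.
  The elements of \<open>K\<close> are taken from the type \<open>'k\<close>. Surjectivity of \<open>p\<close> is part of the
  library predicate \<^term>\<open>perfect_map\<close>.
\<close>

definition perfectly_factors ::
  "'k itself \<Rightarrow> ('a, 'm) monoid_scheme \<Rightarrow> 'a topology \<Rightarrow> 'b topology \<Rightarrow> ('a \<Rightarrow> 'b) \<Rightarrow> bool"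
  where "perfectly_factors (_ :: 'k itself) G T M f \<longleftrightarrow>
    (\<exists>(K :: 'k monoid) S p g.
       topological_group K S \<and> second_countable S \<and>
       p \<in> hom G K \<and> perfect_map T S p \<and>
       continuous_map S M g \<and> (\<forall>x \<in> carrier G. f x = g (p x)))"

text \<open>
  HOL cannot quantify over types inside a definition, so both the metrizable spaces \<open>M\<close> and the
  groups \<open>K\<close> are taken with points in the type \<open>'a\<close> of \<open>G\<close>. This loses nothing: \<open>M\<close> may be replaced
  by the image of \<open>f\<close>, and \<open>K\<close> is an image of \<open>G\<close>. The lemmas \<open>Pm_factorizable_any_space\<close> and
  \<open>perfectly_factors_any_type\<close> below show that the property does not depend on these choices.
\<close>

definition Pm_factorizable :: "('a, 'm) monoid_scheme \<Rightarrow> 'a topology \<Rightarrow> bool"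
  where "Pm_factorizable G T \<longleftrightarrow>
    (\<forall>(M :: 'a topology) f. metrizable_space M \<and> continuous_map T M f \<longrightarrow>
       perfectly_factors TYPE('a) G T M f)"

lemma homeomorphic_maps_section:
  assumes "\<And>x. x \<in> topspace X \<Longrightarrow> t (s x) = x"
  shows "homeomorphic_maps X (pullback_topology (s ` topspace X) t X) s t"
proof -
  have "continuous_map X (pullback_topology (s ` topspace X) t X) s"
  proof (rule continuous_map_pullback')
    show "continuous_map X X (t \<circ> s)"
      by (rule continuous_map_eq[OF continuous_map_id]) (simp add: assms)
  qed auto
  moreover have "continuous_map (pullback_topology (s ` topspace X) t X) X t"
    using continuous_map_pullback[OF continuous_map_id] by (metis id_comp id_apply)
  ultimately show ?thesis
    by (auto simp: homeomorphic_maps_def topspace_pullback_topology assms)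
qed

lemma topological_group_transport:
  fixes K :: "('k, 'n) monoid_scheme" and S' :: "'a topology"
  assumes K: "topological_group K S" and st: "homeomorphic_maps S S' s t"
  defines "K' \<equiv> \<lparr>carrier = topspace S', mult = (\<lambda>a b. s (t a \<otimes>\<^bsub>K\<^esub> t b)), one = s \<one>\<^bsub>K\<^esub>\<rparr>"
  shows "topological_group K' S'" and "s \<in> hom K K'"
proof -
  interpret K: topological_group K S by (rule K)
  have cs: "continuous_map S S' s" and ct: "continuous_map S' S t"
    and ts: "\<And>x. x \<in> carrier K \<Longrightarrow> t (s x) = x" and st': "\<And>y. y \<in> topspace S' \<Longrightarrow> s (t y) = y"
    using st by (auto simp: homeomorphic_maps_def K.topspace_eq_carrier)
  have sc: "s x \<in> topspace S'" if "x \<in> carrier K" for x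
    using cs that by (auto simp: continuous_map_def K.topspace_eq_carrier)
  have tc: "t x \<in> carrier K" if "x \<in> topspace S'" for x
    using ct that by (auto simp: continuous_map_def K.topspace_eq_carrier)
  have grp: "group K'"
  proof (rule groupI)
    fix x assume x: "x \<in> carrier K'"
    show "\<exists>y\<in>carrier K'. y \<otimes>\<^bsub>K'\<^esub> x = \<one>\<^bsub>K'\<^esub>"
      by (rule bexI[of _ "s (inv\<^bsub>K\<^esub> (t x))"]) (use x in \<open>auto simp: K'_def sc tc ts\<close>)
  qed (auto simp: K'_def sc tc ts st' K.m_assoc)
  interpret K': group K' by (rule grp)
  have inv': "inv\<^bsub>K'\<^esub> x = s (inv\<^bsub>K\<^esub> (t x))" if "x \<in> topspace S'" for x
    by (rule K'.inv_equality) (use that in \<open>auto simp: K'_def sc tc ts\<close>)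
  have "continuous_map (prod_topology S' S') (prod_topology S S) (\<lambda>(x, y). (t x, t y))"
    using ct by (simp add: continuous_map_prod_top)
  then have "continuous_map (prod_topology S' S') S' (s \<circ> ((\<lambda>(x, y). x \<otimes>\<^bsub>K\<^esub> y) \<circ> (\<lambda>(x, y). (t x, t y))))"
    by (intro continuous_map_compose[OF _ cs] continuous_map_compose[OF _ K.continuous_mult])
  then have cm: "continuous_map (prod_topology S' S') S' (\<lambda>(x, y). x \<otimes>\<^bsub>K'\<^esub> y)"
    by (rule continuous_map_eq) (auto simp: K'_def)
  have "continuous_map S' S' (s \<circ> ((\<lambda>x. inv\<^bsub>K\<^esub> x) \<circ> t))"
    by (intro continuous_map_compose[OF _ cs] continuous_map_compose[OF ct K.continuous_inv])
  then have ci: "continuous_map S' S' (\<lambda>x. inv\<^bsub>K'\<^esub> x)"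
    by (rule continuous_map_eq) (auto simp: inv')
  have H: "Hausdorff_space S'"
    using K.Hausdorff st homeomorphic_Hausdorff_space homeomorphic_space_def by blast
  show "topological_group K' S'"
    by unfold_locales (use cm ci H in \<open>auto simp: K'_def\<close>)
  show "s \<in> hom K K'"
    by (auto simp: hom_def K'_def sc ts)
qed

lemma perfectly_factors_any_type:
  fixes G :: "('a, 'm) monoid_scheme"
  assumes G: "topological_group G T" and f: "perfectly_factors TYPE('k) G T M f"
  shows "perfectly_factors TYPE('a) G T M f"
proof -
  interpret G: topological_group G T by (rule G)
  obtain K :: "'k monoid" and S p g where K: "topological_group K S" and S: "second_countable S"
    and p: "p \<in> hom G K" "perfect_map T S p" and g: "continuous_map S M g"
    and eq: "\<And>x. x \<in> carrier G \<Longrightarrow> f x = g (p x)"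
    using f by (auto simp: perfectly_factors_def)
  interpret K: topological_group K S by (rule K)
  have im: "p ` carrier G = carrier K"
    using perfect_imp_surjective_map[OF p(2)]
    by (simp add: G.topspace_eq_carrier K.topspace_eq_carrier)
  define s where "s = inv_into (carrier G) p"
  define S' where "S' = pullback_topology (s ` topspace S) p S"
  have ps: "p (s x) = x" if "x \<in> topspace S" for x
    using that im by (auto simp: s_def K.topspace_eq_carrier f_inv_into_f)
  have st: "homeomorphic_maps S S' s p"
    unfolding S'_def by (rule homeomorphic_maps_section) (rule ps)
  define K' where "K' = \<lparr>carrier = topspace S', mult = (\<lambda>a b. s (p a \<otimes>\<^bsub>K\<^esub> p b)), one = s \<one>\<^bsub>K\<^esub>\<rparr>"
  note tr = topological_group_transport[OF K st, folded K'_def]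
  have "S homeomorphic_space S'"
    using st homeomorphic_space_def by blast
  then have S': "second_countable S'"
    using S homeomorphic_space_second_countability by blast
  have "perfect_map S S' s"
    using st by (blast intro: homeomorphic_imp_perfect_map homeomorphic_maps_imp_map)
  then have "perfect_map T S' (s \<circ> p)"
    using p(2) perfect_map_compose by blast
  moreover have "s \<circ> p \<in> hom G K'"
    using p(1) tr(2) by (rule Group.hom_compose)
  moreover have "continuous_map S' M (g \<circ> p)"
    using st g by (auto simp: homeomorphic_maps_def intro: continuous_map_compose)
  moreover have "f x = (g \<circ> p) ((s \<circ> p) x)" if "x \<in> carrier G" for x
  proof -
    have "p x \<in> topspace S"
      using that im by (auto simp: K.topspace_eq_carrier)
    then show ?thesis
      using that by (simp add: ps eq)
  qed
  ultimately show ?thesis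
    unfolding perfectly_factors_def using tr(1) S' by blast
qed

lemma Pm_factorizable_any_space:
  fixes G :: "('a, 'm) monoid_scheme" and M :: "'b topology"
  assumes G: "topological_group G T" and pm: "Pm_factorizable G T"
    and M: "metrizable_space M" and f: "continuous_map T M f"
  shows "perfectly_factors TYPE('a) G T M f"
proof -
  interpret G: topological_group G T by (rule G)
  define D where "D = f ` carrier G"
  define N where "N = subtopology M D"
  define s where "s = inv_into (carrier G) f"
  define M' where "M' = pullback_topology (s ` topspace N) f N"
  have DM: "D \<subseteq> topspace M"
    using f by (auto simp: D_def continuous_map_def G.topspace_eq_carrier)
  then have tN: "topspace N = D"
    by (auto simp: N_def)
  have fs: "f (s x) = x" if "x \<in> topspace N" for x
    using that by (simp add: tN s_def D_def f_inv_into_f)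
  have st: "homeomorphic_maps N M' s f"
    unfolding M'_def by (rule homeomorphic_maps_section) (rule fs)
  then have cs: "continuous_map N M' s" and cf: "continuous_map M' N f"
    by (auto simp: homeomorphic_maps_def)
  have "metrizable_space N"
    unfolding N_def using M by (rule metrizable_space_subtopology)
  moreover have "N homeomorphic_space M'"
    using st homeomorphic_space_def by blast
  ultimately have M': "metrizable_space M'"
    using homeomorphic_metrizable_space by blast
  have "continuous_map T N f"
    using f by (auto simp: N_def D_def continuous_map_in_subtopology G.topspace_eq_carrier)
  then have "continuous_map T M' (s \<circ> f)"
    using cs continuous_map_compose by blast
  then have "perfectly_factors TYPE('a) G T M' (s \<circ> f)"
    using pm M' unfolding Pm_factorizable_def by blast
  then obtain K :: "'a monoid" and S p g where K: "topological_group K S" "second_countable S"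
    "p \<in> hom G K" "perfect_map T S p" and g: "continuous_map S M' g"
    and eq: "\<And>x. x \<in> carrier G \<Longrightarrow> (s \<circ> f) x = g (p x)"
    by (auto simp: perfectly_factors_def)
  have "continuous_map S N (f \<circ> g)"
    using g cf by (rule continuous_map_compose)
  then have "continuous_map S M (f \<circ> g)"
    by (simp add: N_def continuous_map_in_subtopology)
  moreover have "f x = (f \<circ> g) (p x)" if "x \<in> carrier G" for x
  proof -
    have "f x = f ((s \<circ> f) x)"
      using that by (simp add: fs tN D_def)
    then show ?thesis
      using eq[OF that] by simp
  qed
  ultimately show ?thesis
    unfolding perfectly_factors_def using K by blast
qed

end

theory Submission
  imports Defs "HOL-Algebra.Coset"
begin

text \<open>
  Factor \<open>f \<circ> \<pi> = g \<circ> p\<close> with \<open>p : G \<rightarrow> K\<close> perfect and \<open>K\<close> second countable. Then \<open>C = \<pi> (ker p)\<close> is a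
  compact normal subgroup of \<open>H\<close>, so \<open>H \<rightarrow> H/C\<close> is open and perfect, and \<open>f\<close> is constant on the cosets
  of \<open>C\<close>. The composite \<open>G \<rightarrow> H \<rightarrow> H/C\<close> is open and factors through the quotient map \<open>p\<close>, so \<open>H/C\<close> is
  an open continuous image of \<open>K\<close>, hence second countable.
\<close>

section \<open>Quotient topologies\<close>

text \<open>This is the finest topology on the image that keeps \<open>f\<close> continuous.
  Bounding \<open>V\<close> by the image keeps other points of the target type out, so
  \<open>f\<close> is onto.\<close>

definition quotient_topology :: "'a topology \<Rightarrow> ('a \<Rightarrow> 'b) \<Rightarrow> 'b topology"
  where "quotient_topology X f =
    topology (\<lambda>V. V \<subseteq> f ` topspace X \<and> openin X {x \<in> topspace X. f x \<in> V})"

lemma openin_quotient_topology: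
  "openin (quotient_topology X f) V \<longleftrightarrow> V \<subseteq> f ` topspace X \<and> openin X {x \<in> topspace X. f x \<in> V}"
proof -
  have "istopology (\<lambda>V. V \<subseteq> f ` topspace X \<and> openin X {x \<in> topspace X. f x \<in> V})"
    unfolding istopology_def
  proof (intro conjI allI impI; (elim conjE)?)
    fix S T assume "openin X {x \<in> topspace X. f x \<in> S}" "openin X {x \<in> topspace X. f x \<in> T}"
    then have "openin X ({x \<in> topspace X. f x \<in> S} \<inter> {x \<in> topspace X. f x \<in> T})"
      by (rule openin_Int)
    then show "openin X {x \<in> topspace X. f x \<in> S \<inter> T}"
      by (rule arg_cong[where f = "openin X", THEN iffD1, rotated]) auto
  next
    fix \<K> assume "\<forall>K\<in>\<K>. K \<subseteq> f ` topspace X \<and> openin X {x \<in> topspace X. f x \<in> K}"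
    then have "openin X (\<Union>K\<in>\<K>. {x \<in> topspace X. f x \<in> K})"
      by blast
    then show "openin X {x \<in> topspace X. f x \<in> \<Union>\<K>}"
      by (rule arg_cong[where f = "openin X", THEN iffD1, rotated]) auto
  qed auto
  then show ?thesis
    by (simp add: quotient_topology_def)
qed

lemma topspace_quotient_topology [simp]: "topspace (quotient_topology X f) = f ` topspace X"
proof
  have "{x \<in> topspace X. f x \<in> f ` topspace X} = topspace X"
    by auto
  then have "openin (quotient_topology X f) (f ` topspace X)"
    by (simp add: openin_quotient_topology)
  then show "f ` topspace X \<subseteq> topspace (quotient_topology X f)"
    by (rule openin_subset)
qed (use openin_topspace[of "quotient_topology X f"] in \<open>simp only: openin_quotient_topology\<close>)

lemma quotient_map_quotient_topology: "quotient_map X (quotient_topology X f) f"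
  by (auto simp: quotient_map_def openin_quotient_topology)

section \<open>Perfect and open maps\<close>

text \<open>The diagonal of \<open>Y\<close> is the image of the closed diagonal of \<open>X\<close>
  under the square of \<open>f\<close>, which is proper and hence closed.\<close>

lemma Hausdorff_space_perfect_map_image:
  assumes X: "Hausdorff_space X" and f: "perfect_map X Y f"
  shows "Hausdorff_space Y"
proof -
  have "proper_map (prod_topology X X) (prod_topology Y Y) (\<lambda>(x, y). (f x, f y))"
    using f by (simp add: proper_map_prod perfect_imp_proper_map)
  then have "closedin (prod_topology Y Y)
      ((\<lambda>(x, y). (f x, f y)) ` (\<lambda>x. (x, x)) ` topspace X)"
    using X by (simp add: proper_map_def closed_map_def Hausdorff_space_closedin_diagonal)
  also have "(\<lambda>(x, y). (f x, f y)) ` (\<lambda>x. (x, x)) ` topspace X = (\<lambda>y. (y, y)) ` f ` topspace X"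
    by (simp add: image_image)
  finally show ?thesis
    using f by (simp add: Hausdorff_space_closedin_diagonal perfect_imp_surjective_map)
qed

text \<open>Products of quotient maps need not be quotient maps, but perfectness survives products;
  so the square of a perfect coset map is a quotient map.\<close>

lemma perfect_map_prod:
  assumes "perfect_map X X' f" and "perfect_map Y Y' g"
  shows "perfect_map (prod_topology X Y) (prod_topology X' Y') (\<lambda>(x, y). (f x, g y))"
proof -
  have "(\<lambda>(x, y). (f x, g y)) ` (topspace X \<times> topspace Y) = f ` topspace X \<times> g ` topspace Y"
    by (rule image_paired_Times)
  then show ?thesis
    using assms by (simp add: perfect_map_def proper_map_prod continuous_map_prod_top)
qed

text \<open>As \<open>f\<close> is onto, \<open>g\<close> sends \<open>V\<close> to the same set to
  which \<open>g \<circ> f\<close> sends the open preimage of \<open>V\<close>.\<close>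

lemma open_map_from_composition:
  assumes "continuous_map X Y f" and "f ` topspace X = topspace Y" and "open_map X Z (g \<circ> f)"
  shows "open_map Y Z g"
  unfolding open_map_def
proof (intro allI impI)
  fix V assume V: "openin Y V"
  have "f ` {x \<in> topspace X. f x \<in> V} = V"
    using openin_subset[OF V] assms(2) by auto
  then have "(g \<circ> f) ` {x \<in> topspace X. f x \<in> V} = g ` V"
    by (simp only: image_comp[symmetric])
  moreover have "openin X {x \<in> topspace X. f x \<in> V}"
    using assms(1) V by (rule openin_continuous_map_preimage)
  ultimately show "openin Z (g ` V)"
    using assms(3) unfolding open_map_def by metis
qed

section \<open>Coset spaces of a topological group\<close>

context topological_group
begin

definition coset_topology :: "'a set \<Rightarrow> 'a set topology"
  where "coset_topology C = quotient_topology T (\<lambda>x. C #> x)"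

lemma quotient_map_coset: "quotient_map T (coset_topology C) (\<lambda>x. C #> x)"
  unfolding coset_topology_def by (rule quotient_map_quotient_topology)

lemma topspace_coset_topology: "topspace (coset_topology C) = rcosets C"
  by (auto simp: coset_topology_def topspace_eq_carrier RCOSETS_def)

text \<open>Right cosets are equal or disjoint. The form \<open>c \<otimes> x = y\<close> suits the
  description of saturations by multiplication on \<open>C \<times> G\<close>.\<close>

lemma r_coset_eq_iff:
  assumes C: "subgroup C G" and x: "x \<in> carrier G" and y: "y \<in> carrier G"
  shows "C #> x = C #> y \<longleftrightarrow> (\<exists>c\<in>C. c \<otimes> x = y)"
proof
  assume "C #> x = C #> y"
  then have "y \<in> C #> x"
    using rcos_self[OF y C] by simp
  then show "\<exists>c\<in>C. c \<otimes> x = y"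
    by (auto simp: r_coset_def)
next
  assume "\<exists>c\<in>C. c \<otimes> x = y"
  then have "y \<in> C #> x"
    by (auto simp: r_coset_def)
  then show "C #> x = C #> y"
    using repr_independence[OF _ x C] by blast
qed

text \<open>Writing saturations as projections of preimages under multiplication handles open and
  closed sets alike.\<close>

lemma saturation_eq_projection:
  assumes C: "subgroup C G" and W: "W \<subseteq> carrier G"
  shows "{x \<in> topspace T. C #> x \<in> (\<lambda>x. C #> x) ` W} =
    snd ` {z \<in> topspace (prod_topology (subtopology T C) T). (\<lambda>(c, x). c \<otimes> x) z \<in> W}"
    (is "?L = ?R")
proof
  show "?L \<subseteq> ?R"
  proof
    fix x assume "x \<in> ?L"
    then obtain w where x: "x \<in> carrier G" and w: "w \<in> W" "C #> x = C #> w"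
      by (auto simp: topspace_eq_carrier)
    then obtain c where "c \<in> C" "c \<otimes> x = w"
      using r_coset_eq_iff[OF C x] W by blast
    then show "x \<in> ?R"
      using x w subgroup.subset[OF C] by (force simp: topspace_eq_carrier)
  qed
  show "?R \<subseteq> ?L"
  proof
    fix x assume "x \<in> ?R"
    then obtain c where x: "x \<in> carrier G" and c: "c \<in> C" "c \<otimes> x \<in> W"
      by (auto simp: topspace_eq_carrier)
    then have "C #> x = C #> (c \<otimes> x)"
      using r_coset_eq_iff[OF C x] W by blast
    then show "x \<in> ?L"
      using x c by (auto simp: topspace_eq_carrier)
  qed
qed

lemma continuous_map_mult_subtopology:
  "continuous_map (prod_topology (subtopology T C) T) T (\<lambda>(c, x). c \<otimes> x)"
  by (metis continuous_map_from_subtopology continuous_mult prod_topology_subtopology(1))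

text \<open>Projections of products are open, so saturations of open sets are open.\<close>

lemma open_map_coset:
  assumes C: "subgroup C G"
  shows "open_map T (coset_topology C) (\<lambda>x. C #> x)"
  unfolding open_map_def
proof (intro allI impI)
  fix W assume W: "openin T W"
  then have sub: "W \<subseteq> carrier G"
    using openin_subset topspace_eq_carrier by blast
  have "openin T {x \<in> topspace T. C #> x \<in> (\<lambda>x. C #> x) ` W}"
    unfolding saturation_eq_projection[OF C sub]
    by (rule open_map_snd[unfolded open_map_def, rule_format])
      (rule openin_continuous_map_preimage[OF continuous_map_mult_subtopology W])
  then show "openin (coset_topology C) ((\<lambda>x. C #> x) ` W)"
    unfolding coset_topology_def openin_quotient_topology
    using image_mono[OF sub] by (simp add: topspace_eq_carrier)
qed

text \<open>Projection along the compact factor \<open>C\<close> is closed, so saturations of closed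
  sets are closed.\<close>

lemma closed_map_coset:
  assumes C: "subgroup C G" and compact: "compactin T C"
  shows "closed_map T (coset_topology C) (\<lambda>x. C #> x)"
  unfolding closed_map_def
proof (intro allI impI)
  fix W assume W: "closedin T W"
  then have sub: "W \<subseteq> carrier G"
    using closedin_subset topspace_eq_carrier by blast
  have "closed_map (prod_topology (subtopology T C) T) T snd"
    using compact by (simp add: closed_map_snd compact_space_subtopology)
  then have "closedin T {x \<in> topspace T. C #> x \<in> (\<lambda>x. C #> x) ` W}"
    unfolding saturation_eq_projection[OF C sub] closed_map_def
    using closedin_continuous_map_preimage[OF continuous_map_mult_subtopology W] by blast
  moreover have "(\<lambda>x. C #> x) ` W \<subseteq> topspace (coset_topology C)"
    using sub by (auto simp: coset_topology_def topspace_eq_carrier)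
  ultimately show "closedin (coset_topology C) ((\<lambda>x. C #> x) ` W)"
    using quotient_map_coset[of C] unfolding quotient_map_closedin by blast
qed

lemma compactin_r_coset:
  assumes "compactin T C" and y: "y \<in> carrier G"
  shows "compactin T (C #> y)"
proof -
  have "continuous_map T T (\<lambda>x. (\<lambda>(x, y). x \<otimes> y) (x, y))"
    using y by (intro continuous_map_compose[OF _ continuous_mult, unfolded o_def])
      (simp add: continuous_map_pairedI topspace_eq_carrier)
  then have "compactin T ((\<lambda>x. x \<otimes> y) ` C)"
    using assms(1) image_compactin by fastforce
  then show ?thesis
    by (simp add: r_coset_def UNION_singleton_eq_range)
qed

text \<open>Fibres of the coset map are the cosets themselves, compact as translates of
  \<open>C\<close>.\<close>

lemma perfect_map_coset:
  assumes C: "subgroup C G" and compact: "compactin T C"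
  shows "perfect_map T (coset_topology C) (\<lambda>x. C #> x)"
proof -
  have "compactin T {x \<in> topspace T. C #> x = Y}" if Y: "Y \<in> topspace (coset_topology C)" for Y
  proof -
    obtain y where y: "y \<in> carrier G" "Y = C #> y"
      using Y by (auto simp: topspace_coset_topology RCOSETS_def)
    have "{x \<in> topspace T. C #> x = Y} = C #> y"
    proof
      show "{x \<in> topspace T. C #> x = Y} \<subseteq> C #> y"
        using rcos_self[OF _ C] y(2) by (auto simp: topspace_eq_carrier)
      show "C #> y \<subseteq> {x \<in> topspace T. C #> x = Y}"
        using repr_independence[OF _ y(1) C] r_coset_subset_G[OF subgroup.subset[OF C] y(1)] y(2)
        by (auto simp: topspace_eq_carrier)
    qed
    then show ?thesis
      using compactin_r_coset[OF compact y(1)] by simp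
  qed
  then show ?thesis
    unfolding perfect_map_def proper_map_def
    using closed_map_coset[OF assms] quotient_imp_continuous_map[OF quotient_map_coset]
      quotient_imp_surjective_map[OF quotient_map_coset] by blast
qed

text \<open>Both operations descend along quotient maps, and the Hausdorff property passes along the
  perfect coset map.\<close>

lemma topological_group_FactGroup:
  assumes C: "C \<lhd> G" and compact: "compactin T C"
  shows "topological_group (G Mod C) (coset_topology C)"
proof -
  interpret C: normal C G by (rule C)
  let ?q = "\<lambda>x. C #> x"
  let ?S = "coset_topology C"
  interpret Q: group "G Mod C" by (rule C.factorgroup_is_group)
  note perf = perfect_map_coset[OF C.subgroup_axioms compact]
  note cq = perfect_imp_continuous_map[OF perf]
  have "continuous_map (prod_topology T T) ?S (?q \<circ> (\<lambda>(x, y). x \<otimes> y))"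
    by (rule continuous_map_compose[OF continuous_mult cq])
  then have "continuous_map (prod_topology T T) ?S
      ((\<lambda>(A, B). A \<otimes>\<^bsub>G Mod C\<^esub> B) \<circ> (\<lambda>(x, y). (?q x, ?q y)))"
    by (rule continuous_map_eq) (auto simp: topspace_eq_carrier C.rcos_sum)
  \<comment> \<open>Continuity may be tested on \<open>G \<times> G\<close> because the square of
    the perfect map \<open>?q\<close> is again perfect, hence a quotient map.\<close>
  then have cm: "continuous_map (prod_topology ?S ?S) ?S (\<lambda>(A, B). A \<otimes>\<^bsub>G Mod C\<^esub> B)"
    by (rule continuous_compose_quotient_map[OF
          perfect_imp_quotient_map[OF perfect_map_prod[OF perf perf]]])
  have "continuous_map T ?S (?q \<circ> (\<lambda>x. inv x))"
    by (rule continuous_map_compose[OF continuous_inv cq])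
  then have "continuous_map T ?S ((\<lambda>A. inv\<^bsub>G Mod C\<^esub> A) \<circ> ?q)"
    by (rule continuous_map_eq)
      (auto simp: topspace_eq_carrier C.inv_FactGroup C.rcos_inv carrier_FactGroup)
  then have ci: "continuous_map ?S ?S (\<lambda>A. inv\<^bsub>G Mod C\<^esub> A)"
    by (rule continuous_compose_quotient_map[OF quotient_map_coset])
  show ?thesis
    using cm ci Hausdorff_space_perfect_map_image[OF Hausdorff perf]
    by unfold_locales (simp_all add: topspace_coset_topology FactGroup_def)
qed

end

section \<open>Descent from \<open>G\<close> to \<open>H\<close> and its quotient\<close>

text \<open>By surjectivity each conjugating element lifts to \<open>G\<close>, where conjugation
  preserves \<open>N\<close>.\<close>

lemma (in group_hom) normal_image:
  assumes N: "N \<lhd> G" and surj: "h ` carrier G = carrier H"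
  shows "h ` N \<lhd> H"
proof -
  interpret N: normal N G by (rule N)
  have "x \<otimes>\<^bsub>H\<^esub> y \<otimes>\<^bsub>H\<^esub> inv\<^bsub>H\<^esub> x \<in> h ` N" if x: "x \<in> carrier H" and y: "y \<in> h ` N" for x y
  proof -
    obtain a n where a: "a \<in> carrier G" "x = h a" and n: "n \<in> N" "y = h n"
      using x y surj by blast
    then have "x \<otimes>\<^bsub>H\<^esub> y \<otimes>\<^bsub>H\<^esub> inv\<^bsub>H\<^esub> x = h (a \<otimes> n \<otimes> inv a)"
      by (simp add: N.mem_carrier)
    then show ?thesis
      using N.inv_op_closed2[OF a(1) n(1)] by simp
  qed
  then show ?thesis
    using subgroup_img_is_subgroup[OF N.subgroup_axioms] by (simp add: H.normal_inv_iff)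
qed

theorem corollary5p6:
  fixes G :: "('a, 'm) monoid_scheme" and T :: "'a topology"
    and H :: "('b, 'n) monoid_scheme" and U :: "'b topology"
    and \<pi> :: "'a \<Rightarrow> 'b"
  assumes "topological_group G T" and "topological_group H U"
    and "\<pi> \<in> hom G H" and "\<pi> ` carrier G = carrier H"
    and "continuous_map T U \<pi>" and "open_map T U \<pi>"
    and "Pm_factorizable G T"
  shows "Pm_factorizable H U"
  unfolding Pm_factorizable_def
proof (intro allI impI, elim conjE)
  fix M :: "'b topology" and f
  assume M: "metrizable_space M" and f: "continuous_map U M f"
  interpret G: topological_group G T by fact
  interpret H: topological_group H U by fact
  interpret \<pi>: group_hom G H \<pi>
    using assms(3) by unfold_locales
  have "continuous_map T M (f \<circ> \<pi>)"
    using assms(5) f by (rule continuous_map_compose)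
  \<comment> \<open>\<open>M\<close> has its points in \<open>'b\<close>, so the version of the
    hypothesis for arbitrary point types is used.\<close>
  then have "perfectly_factors TYPE('a) G T M (f \<circ> \<pi>)"
    by (rule Pm_factorizable_any_space[OF assms(1,7) M])
  then obtain K :: "'a monoid" and S p g where K: "topological_group K S" and S: "second_countable S"
    and p: "p \<in> hom G K" "perfect_map T S p"
    and eq: "\<And>x. x \<in> carrier G \<Longrightarrow> f (\<pi> x) = g (p x)"
    by (auto simp: perfectly_factors_def)
  interpret K: topological_group K S by (rule K)
  interpret p: group_hom G K p
    using p(1) by unfold_locales
  define C where "C = \<pi> ` kernel G K p"
  let ?q = "\<lambda>y. C #>\<^bsub>H\<^esub> y"
  have C: "C \<lhd> H"
    unfolding C_def by (rule \<pi>.normal_image[OF p.normal_kernel assms(4)])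
  then interpret C: normal C H .
  \<comment> \<open>The kernel is the fibre of the perfect map \<open>p\<close> over the
    identity.\<close>
  have "compactin T (kernel G K p)"
    using p(2) K.one_closed
    by (simp add: kernel_def perfect_map_def proper_map_def
        flip: G.topspace_eq_carrier K.topspace_eq_carrier)
  then have compact: "compactin U C"
    unfolding C_def using assms(5) by (rule image_compactin)
  note perf = H.perfect_map_coset[OF C.subgroup_axioms compact]
  have q\<pi>: "continuous_map T (H.coset_topology C) (?q \<circ> \<pi>)"
    by (rule continuous_map_compose[OF assms(5) perfect_imp_continuous_map[OF perf]])
  \<comment> \<open>Points of one fibre of \<open>p\<close> differ by a kernel element, whose image
    under \<open>\<pi>\<close> lies in \<open>C\<close>.\<close>
  have "(?q \<circ> \<pi>) x = (?q \<circ> \<pi>) y"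
    if "x \<in> topspace T" "y \<in> topspace T" "p x = p y" for x y
  proof -
    have x: "x \<in> carrier G" and y: "y \<in> carrier G"
      using that by (simp_all add: G.topspace_eq_carrier)
    have "y \<otimes>\<^bsub>G\<^esub> inv\<^bsub>G\<^esub> x \<in> kernel G K p"
      using x y that(3) by (simp add: kernel_def)
    moreover have "\<pi> (y \<otimes>\<^bsub>G\<^esub> inv\<^bsub>G\<^esub> x) \<otimes>\<^bsub>H\<^esub> \<pi> x = \<pi> y"
      using x y by (simp add: H.m_assoc)
    ultimately have "\<exists>c\<in>C. c \<otimes>\<^bsub>H\<^esub> \<pi> x = \<pi> y"
      unfolding C_def by blast
    then show ?thesis
      using H.r_coset_eq_iff[OF C.subgroup_axioms] x y by simp
  qed
  \<comment> \<open>The induced map from \<open>K\<close> onto the coset space; it is continuous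
    since the perfect map \<open>p\<close> is a quotient map.\<close>
  then obtain r where r: "continuous_map S (H.coset_topology C) r"
    and surj: "r ` topspace S = (?q \<circ> \<pi>) ` topspace T"
    and rp: "\<And>x. x \<in> topspace T \<Longrightarrow> r (p x) = (?q \<circ> \<pi>) x"
    by (rule quotient_map_lift_exists[OF perfect_imp_quotient_map[OF p(2)] q\<pi>]) blast+
  have "open_map T (H.coset_topology C) (?q \<circ> \<pi>)"
    using assms(6) H.open_map_coset[OF C.subgroup_axioms] by (rule open_map_compose)
  then have "open_map T (H.coset_topology C) (r \<circ> p)"
    by (rule open_map_eq) (simp add: rp)
  then have "open_map S (H.coset_topology C) r"
    by (rule open_map_from_composition[OF perfect_imp_continuous_map[OF p(2)]
          perfect_imp_surjective_map[OF p(2)]])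
  moreover have "r ` topspace S = topspace (H.coset_topology C)"
    using perfect_imp_surjective_map[OF perf] assms(4)
    by (simp only: surj image_comp[symmetric] G.topspace_eq_carrier H.topspace_eq_carrier)
  ultimately have sc: "second_countable (H.coset_topology C)"
    using S r second_countable_open_map_image by blast
  \<comment> \<open>Write \<open>y = \<pi> x\<close> and \<open>z = \<pi> (k \<otimes> x)\<close>
    with \<open>k\<close> in the kernel: \<open>p\<close> does not distinguish \<open>x\<close> from
    \<open>k \<otimes> x\<close>, so \<open>g \<circ> p\<close> gives both the same value.\<close>
  have "f y = f z" if "y \<in> topspace U" "z \<in> topspace U" and yz: "?q y = ?q z" for y z
  proof -
    have y: "y \<in> carrier H" and z: "z \<in> carrier H"
      using that by (simp_all add: H.topspace_eq_carrier)
    obtain k where k: "k \<in> kernel G K p" and kz: "\<pi> k \<otimes>\<^bsub>H\<^esub> y = z"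
      using H.r_coset_eq_iff[OF C.subgroup_axioms y z] yz by (auto simp: C_def)
    obtain x where x: "x \<in> carrier G" "y = \<pi> x"
      using y assms(4) by blast
    have kG: "k \<in> carrier G" and pk: "p k = \<one>\<^bsub>K\<^esub>"
      using k by (auto simp: kernel_def)
    have "f z = f (\<pi> (k \<otimes>\<^bsub>G\<^esub> x))"
      using x kG kz by simp
    also have "\<dots> = g (p (k \<otimes>\<^bsub>G\<^esub> x))"
      using x kG by (intro eq) simp
    also have "\<dots> = g (p x)"
      using x kG pk by simp
    finally show ?thesis
      using x eq by simp
  qed
  then obtain g' where g': "continuous_map (H.coset_topology C) M g'"
    and fg': "\<And>y. y \<in> topspace U \<Longrightarrow> g' (?q y) = f y"
    by (rule quotient_map_lift_exists[OF H.quotient_map_coset f]) blast+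
  \<comment> \<open>Elements of \<open>H Mod C\<close> are sets of elements of \<open>H\<close>; the
    resulting factorization is moved back to the type \<open>'b\<close> afterwards.\<close>
  have "perfectly_factors TYPE('b set) H U M f"
    unfolding perfectly_factors_def
  proof (intro exI conjI ballI)
    show "topological_group (H Mod C) (H.coset_topology C)"
      by (rule H.topological_group_FactGroup[OF C compact])
    show "f y = g' (?q y)" if "y \<in> carrier H" for y
      using that fg' by (simp add: H.topspace_eq_carrier)
  qed (fact sc C.r_coset_hom_Mod perf g')+
  then show "perfectly_factors TYPE('b) H U M f"
    by (rule perfectly_factors_any_type[OF assms(2)])
qed

end
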